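(* Let $G=(g_{uv})_{1\le u,v\le m}$ be a symmetric complex $m\times m$ matrix with units on the diagonal such that $\mathrm{rank}\,G\le 2r$ for an integer $r$. Suppose that $0<\varkappa<1$ and that for any $u,v\in[m]$ either $|g_{uv}-1|>\varkappa$ or $|g_{uv}-1|<2^{-4(r+1)}\varkappa$. Then the simplicial complex $\mathcal K(G,\varkappa)$ collapses on a subcomplex of dimension less than $r$.
   Context: $[m]=\{1,\dots,m\}$. $\Gamma(G,\varkappa)$ is the graph on $[m]$ in which $\{u,v\}$ ($u\ne v$) is an edge iff $|g_{uv}-1|<\varkappa$; $\mathcal K(G,\varkappa)$ is its clique complex: the simplicial complex on $[m]$ whose simplices are the subsets of $[m]$ whose elements are pairwise joined by edges of $\Gamma(G,\varkappa)$. A pair of non-empty simplices $(\sigma,\tau)$ is a free pair of a simplicial complex $K$ if $\tau$ is a codimension-one face of $\sigma$ and $K\setminus\{\sigma,\tau\}$ is a simplicial complex; removing it is an elementary collapse; $K$ collapses on $L$ if $L$ is obtained from $K$ by finitely many elementary collapses. Dimension of a simplex is its cardinality minus one. *)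

theory Defs
  imports "HOL-Analysis.Analysis"
begin

definition simplicial_complex :: "'a set set \<Rightarrow> bool" where
  "simplicial_complex K \<longleftrightarrow> (\<forall>\<sigma>\<in>K. finite \<sigma> \<and> (\<forall>\<tau>. \<tau> \<subseteq> \<sigma> \<longrightarrow> \<tau> \<in> K))"

definition Gamma_edge :: "complex^'n^'n \<Rightarrow> real \<Rightarrow> 'n \<Rightarrow> 'n \<Rightarrow> bool" where
  "Gamma_edge G \<kappa> u v \<longleftrightarrow> u \<noteq> v \<and> cmod (G $ u $ v - 1) < \<kappa>"

definition clique_complex :: "complex^'n^'n \<Rightarrow> real \<Rightarrow> 'n set set" where
  "clique_complex G \<kappa> = {\<sigma>. \<forall>u\<in>\<sigma>. \<forall>v\<in>\<sigma>. u \<noteq> v \<longrightarrow> Gamma_edge G \<kappa> u v}"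

definition free_pair :: "'a set set \<Rightarrow> 'a set \<Rightarrow> 'a set \<Rightarrow> bool" where
  "free_pair K \<sigma> \<tau> \<longleftrightarrow> \<sigma> \<in> K \<and> \<tau> \<in> K \<and> \<sigma> \<noteq> {} \<and> \<tau> \<noteq> {} \<and> finite \<sigma> \<and>
     \<tau> \<subseteq> \<sigma> \<and> card \<sigma> = card \<tau> + 1 \<and> simplicial_complex (K - {\<sigma>, \<tau>})"

definition elementary_collapse :: "'a set set \<Rightarrow> 'a set set \<Rightarrow> bool" where
  "elementary_collapse K L \<longleftrightarrow> (\<exists>\<sigma> \<tau>. free_pair K \<sigma> \<tau> \<and> L = K - {\<sigma>, \<tau>})"

definition collapses_on :: "'a set set \<Rightarrow> 'a set set \<Rightarrow> bool" where
  "collapses_on K L \<longleftrightarrow> elementary_collapse\<^sup>*\<^sup>* K L"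

definition simplex_dim :: "'a set \<Rightarrow> int" where
  "simplex_dim \<sigma> = int (card \<sigma>) - 1"

end

theory Submission
  imports Defs
begin

text \<open>Up to isotropic error, a clique spans an isotropic space, and the idea is to build the collapse
by induction on the number of vertices: a collapse of the complex without a vertex \<open>v\<close> and a
collapse of the link of \<open>v\<close> to one dimension less combine to a collapse of the whole complex.
In the first link, projecting the Gram vectors orthogonally to \<open>v\<close> gives a matrix with
tiny diagonal, of rank at most \<open>2r - 1\<close>, whose entry is tiny exactly at the edges. From then
on, choose the entry \<open>(a, w)\<close> of largest modulus among the remaining vertices. If it is tiny,
the complex is a full simplex. Otherwise, in the link of \<open>a\<close>, taking the Schur complement with respect
to the almost hyperbolic plane of \<open>a\<close> and \<open>w\<close> lowers the rank by two, and maximality of the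
entry keeps the perturbation of all entries tiny.\<close>

section \<open>Collapses above a given dimension\<close>

text \<open>The empty simplex may take part in a step when \<open>s = 0\<close>, so that collapses of links extend to
collapses of cones.\<close>

definition collapse_step :: "nat \<Rightarrow> 'a set set \<Rightarrow> 'a set set \<Rightarrow> bool" where
  "collapse_step s K L \<longleftrightarrow> (\<exists>\<sigma> \<tau>. \<sigma> \<in> K \<and> \<tau> \<in> K \<and> finite \<sigma> \<and> \<tau> \<subseteq> \<sigma> \<and>
     card \<sigma> = card \<tau> + 1 \<and> s \<le> card \<tau> \<and> (\<forall>\<rho>\<in>K. \<tau> \<subseteq> \<rho> \<longrightarrow> \<rho> = \<sigma> \<or> \<rho> = \<tau>) \<and> L = K - {\<sigma>, \<tau>})"

text \<open>Cardinality at most \<open>s\<close> is dimension less than \<open>s\<close>. Closure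
  under subsets is not asked for; it is recovered step by step when collapse steps become elementary
  collapses.\<close>

definition collapses_below :: "nat \<Rightarrow> 'a set set \<Rightarrow> bool" where
  "collapses_below s K \<longleftrightarrow> (\<exists>L. (collapse_step s)\<^sup>*\<^sup>* K L \<and> (\<forall>\<sigma>\<in>L. card \<sigma> \<le> s))"

section \<open>Collapse steps in cones and unions\<close>

lemma collapse_stepI:
  assumes "\<sigma> \<in> K" "\<tau> \<in> K" "finite \<sigma>" "\<tau> \<subseteq> \<sigma>" "card \<sigma> = card \<tau> + 1" "s \<le> card \<tau>"
    and "\<And>\<rho>. \<rho> \<in> K \<Longrightarrow> \<tau> \<subseteq> \<rho> \<Longrightarrow> \<rho> = \<sigma> \<or> \<rho> = \<tau>" and "L = K - {\<sigma>, \<tau>}"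
  shows "collapse_step s K L"
  unfolding collapse_step_def by (rule exI[of _ \<sigma>], rule exI[of _ \<tau>]) (use assms in simp)

lemma collapse_step_subset: "collapse_step s K L \<Longrightarrow> L \<subseteq> K"
  unfolding collapse_step_def by blast

lemma collapse_steps_subset: "(collapse_step s)\<^sup>*\<^sup>* K L \<Longrightarrow> L \<subseteq> K"
  by (induction rule: rtranclp_induct) (blast dest: collapse_step_subset)+

text \<open>No member of \<open>M\<close> contains \<open>v\<close>, so the members containing
  \<open>insert v \<tau>\<close> come from members of \<open>K\<close> containing \<tau>, and
  freeness carries over. Coning adds one element, hence \<open>Suc s\<close>.\<close>

lemma collapse_step_cone:
  assumes step: "collapse_step s K L" and vK: "v \<notin> \<Union>K" and vM: "v \<notin> \<Union>M"
  shows "collapse_step (Suc s) (M \<union> insert v ` K) (M \<union> insert v ` L)"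
proof -
  obtain \<sigma> \<tau> where *: "\<sigma> \<in> K" "\<tau> \<in> K" "finite \<sigma>" "\<tau> \<subseteq> \<sigma>" "card \<sigma> = card \<tau> + 1" "s \<le> card \<tau>"
    and free: "\<And>\<rho>. \<rho> \<in> K \<Longrightarrow> \<tau> \<subseteq> \<rho> \<Longrightarrow> \<rho> = \<sigma> \<or> \<rho> = \<tau>" and L: "L = K - {\<sigma>, \<tau>}"
    using step unfolding collapse_step_def by blast
  have fin: "finite \<tau>" using * finite_subset by blast
  have inj: "inj_on (insert v) K"
    using vK by (intro inj_onI) (metis Diff_insert_absorb UnionI)
  have "insert v ` L = insert v ` K - {insert v \<sigma>, insert v \<tau>}"
    unfolding L using inj_on_image_set_diff[OF inj, of K "{\<sigma>, \<tau>}"] * by auto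
  moreover have "insert v \<sigma> \<notin> M" "insert v \<tau> \<notin> M" using vM by auto
  ultimately have "M \<union> insert v ` L = (M \<union> insert v ` K) - {insert v \<sigma>, insert v \<tau>}"
    by auto
  moreover have "\<rho> = insert v \<sigma> \<or> \<rho> = insert v \<tau>"
    if "\<rho> \<in> M \<union> insert v ` K" "insert v \<tau> \<subseteq> \<rho>" for \<rho>
  proof -
    obtain \<rho>' where "\<rho>' \<in> K" "\<rho> = insert v \<rho>'" using \<open>\<rho> \<in> _\<close> \<open>insert v \<tau> \<subseteq> \<rho>\<close> vM by auto
    moreover have "\<tau> \<subseteq> \<rho>'"
      using \<open>insert v \<tau> \<subseteq> \<rho>\<close> \<open>\<rho> = insert v \<rho>'\<close> \<open>\<tau> \<in> K\<close> vK by auto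
    ultimately show ?thesis using free by blast
  qed
  moreover have "v \<notin> \<sigma>" "v \<notin> \<tau>" using * vK by auto
  then have "card (insert v \<sigma>) = card (insert v \<tau>) + 1" "Suc s \<le> card (insert v \<tau>)"
    using * fin by simp_all
  moreover have "insert v \<tau> \<subseteq> insert v \<sigma>" "finite (insert v \<sigma>)" using * by auto
  moreover have "insert v \<sigma> \<in> M \<union> insert v ` K" "insert v \<tau> \<in> M \<union> insert v ` K"
    using * by simp_all
  ultimately show ?thesis by (intro collapse_stepI[of "insert v \<sigma>" _ "insert v \<tau>"])
qed

lemma collapse_steps_cone:
  assumes "(collapse_step s)\<^sup>*\<^sup>* K L" "v \<notin> \<Union>K" "v \<notin> \<Union>M"
  shows "(collapse_step (Suc s))\<^sup>*\<^sup>* (M \<union> insert v ` K) (M \<union> insert v ` L)"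
  using assms(1)
proof (induction rule: rtranclp_induct)
  case (step L L')
  have "v \<notin> \<Union>L" using collapse_steps_subset[OF step.hyps(1)] assms(2) by blast
  from collapse_step_cone[OF step.hyps(2) this assms(3)] step.IH show ?case by simp
qed simp

lemma collapse_step_mono: "collapse_step (Suc s) K L \<Longrightarrow> collapse_step s K L"
  unfolding collapse_step_def by (elim ex_forward conj_forward) simp_all

text \<open>A member of \<open>M\<close> containing \<tau> is no larger than \<tau>, hence equal to
  it: small leftovers never spoil freeness.\<close>

lemma collapse_step_union:
  assumes step: "collapse_step s K L" and small: "\<And>\<rho>. \<rho> \<in> M \<Longrightarrow> finite \<rho> \<and> card \<rho> \<le> s"
    and disj: "K \<inter> M = {}"
  shows "collapse_step s (K \<union> M) (L \<union> M)"
proof -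
  obtain \<sigma> \<tau> where *: "\<sigma> \<in> K" "\<tau> \<in> K" "finite \<sigma>" "\<tau> \<subseteq> \<sigma>" "card \<sigma> = card \<tau> + 1" "s \<le> card \<tau>"
    and free: "\<forall>\<rho>\<in>K. \<tau> \<subseteq> \<rho> \<longrightarrow> \<rho> = \<sigma> \<or> \<rho> = \<tau>" and L: "L = K - {\<sigma>, \<tau>}"
    using step unfolding collapse_step_def by blast
  have "\<rho> = \<tau>" if "\<rho> \<in> M" "\<tau> \<subseteq> \<rho>" for \<rho>
    using small[OF that(1)] that(2) \<open>s \<le> card \<tau>\<close> by (metis card_seteq order_trans)
  then have "\<rho> = \<sigma> \<or> \<rho> = \<tau>" if "\<rho> \<in> K \<union> M" "\<tau> \<subseteq> \<rho>" for \<rho>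
    using that free by blast
  moreover have "L \<union> M = K \<union> M - {\<sigma>, \<tau>}" using L disj * by auto
  ultimately show ?thesis using * by (intro collapse_stepI[of \<sigma> _ \<tau>]) simp_all
qed

lemma collapse_steps_union:
  assumes "(collapse_step s)\<^sup>*\<^sup>* K L" "\<And>\<rho>. \<rho> \<in> M \<Longrightarrow> finite \<rho> \<and> card \<rho> \<le> s" "K \<inter> M = {}"
  shows "(collapse_step s)\<^sup>*\<^sup>* (K \<union> M) (L \<union> M)"
  using assms(1)
proof (induction rule: rtranclp_induct)
  case (step L L')
  have "L \<inter> M = {}" using collapse_steps_subset[OF step.hyps(1)] assms(3) by blast
  from collapse_step_union[OF step.hyps(2) assms(2) this] step.IH show ?case by simp
qed simp

text \<open>Think of \<open>N\<close> as the link of \<open>v\<close> and of \<open>K\<close> as its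
  deletion. The cone over \<open>N\<close> is collapsed first; what remains of it has at most
  \<open>Suc s\<close> elements per set and cannot block the collapse of \<open>K\<close>.\<close>

lemma collapses_below_cone:
  assumes link: "collapses_below s N" and del: "collapses_below (Suc s) K"
    and v: "v \<notin> \<Union>K" "v \<notin> \<Union>N" and fin: "\<And>\<rho>. \<rho> \<in> N \<Longrightarrow> finite \<rho>"
  shows "collapses_below (Suc s) (K \<union> insert v ` N)"
proof -
  obtain N' where N': "(collapse_step s)\<^sup>*\<^sup>* N N'" "\<forall>\<sigma>\<in>N'. card \<sigma> \<le> s"
    using link unfolding collapses_below_def by blast
  obtain K' where K': "(collapse_step (Suc s))\<^sup>*\<^sup>* K K'" "\<forall>\<sigma>\<in>K'. card \<sigma> \<le> Suc s"
    using del unfolding collapses_below_def by blast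
  have 1: "(collapse_step (Suc s))\<^sup>*\<^sup>* (K \<union> insert v ` N) (K \<union> insert v ` N')"
    using collapse_steps_cone[OF N'(1) v(2) v(1)] .
  have sub: "N' \<subseteq> N" by (rule collapse_steps_subset[OF N'(1)])
  have small: "finite \<rho> \<and> card \<rho> \<le> Suc s" if "\<rho> \<in> insert v ` N'" for \<rho>
  proof -
    obtain \<rho>' where "\<rho>' \<in> N'" "\<rho> = insert v \<rho>'" using \<open>\<rho> \<in> insert v ` N'\<close> by blast
    moreover have "finite \<rho>'" "card \<rho>' \<le> s" using N'(2) fin sub \<open>\<rho>' \<in> N'\<close> by auto
    ultimately show ?thesis by (simp add: card_insert_if)
  qed
  have "K \<inter> insert v ` N' = {}" using v(1) by auto
  from collapse_steps_union[OF K'(1) small this]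
  have "(collapse_step (Suc s))\<^sup>*\<^sup>* (K \<union> insert v ` N) (K' \<union> insert v ` N')"
    using 1 by simp
  then show ?thesis unfolding collapses_below_def using K'(2) small by blast
qed

section \<open>Collapsing a full simplex\<close>

lemma collapse_Pow_empty: "finite V \<Longrightarrow> V \<noteq> {} \<Longrightarrow> (collapse_step 0)\<^sup>*\<^sup>* (Pow V) {}"
proof (induction rule: finite_ne_induct)
  case (singleton a)
  have "collapse_step 0 (Pow {a}) {}"
    \<comment> \<open>Threshold 0 permits removing the last vertex together with the empty
      simplex.\<close>
    by (rule collapse_stepI[of "{a}" _ "{}"]) auto
  then show ?case by blast
next
  case (insert v V)
  \<comment> \<open>The cone with apex \<open>v\<close> is removed first, by coning the collapse
    from the induction hypothesis; the base is left.\<close>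
  have "(collapse_step (Suc 0))\<^sup>*\<^sup>* (Pow V \<union> insert v ` Pow V) (Pow V \<union> insert v ` {})"
    using insert by (intro collapse_steps_cone) auto
  then have "(collapse_step 0)\<^sup>*\<^sup>* (Pow V \<union> insert v ` Pow V) (Pow V)"
    using rtranclp_mono[of "collapse_step (Suc 0)" "collapse_step 0"] collapse_step_mono by (auto simp: le_fun_def)
  with insert.IH show ?case by (simp add: Pow_insert)
qed

lemma collapses_below_Pow:
  assumes "finite V"
  shows "collapses_below s (Pow V)"
  using assms
proof (induction arbitrary: s rule: finite_induct)
  case empty
  show ?case unfolding collapses_below_def by (intro exI[of _ "{{}}"]) auto
next
  case (insert v V)
  show ?case
  proof (cases s)
    case 0
    then show ?thesis using collapse_Pow_empty[of "insert v V"] insert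
      unfolding collapses_below_def by (intro exI[of _ "{}"]) auto
  next
    case (Suc t)
    \<comment> \<open>A full simplex is a cone: link and deletion of \<open>v\<close> are both
      \<open>Pow V\<close>.\<close>
    have "collapses_below (Suc t) (Pow V \<union> insert v ` Pow V)"
      using insert finite_subset by (intro collapses_below_cone) auto
    then show ?thesis by (simp add: Suc Pow_insert)
  qed
qed

section \<open>From collapse steps to elementary collapses\<close>

lemma collapse_step_elementary:
  assumes K: "simplicial_complex K" and step: "collapse_step (Suc s) K L"
  shows "simplicial_complex L \<and> elementary_collapse K L"
proof -
  obtain \<sigma> \<tau> where *: "\<sigma> \<in> K" "\<tau> \<in> K" "finite \<sigma>" "\<tau> \<subseteq> \<sigma>" "card \<sigma> = card \<tau> + 1" "Suc s \<le> card \<tau>"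
    and free: "\<forall>\<rho>\<in>K. \<tau> \<subseteq> \<rho> \<longrightarrow> \<rho> = \<sigma> \<or> \<rho> = \<tau>" and L: "L = K - {\<sigma>, \<tau>}"
    using step unfolding collapse_step_def by blast
  have "finite \<rho>" "\<rho>' \<in> L" if "\<rho> \<in> L" "\<rho>' \<subseteq> \<rho>" for \<rho> \<rho>'
  proof -
    have "\<rho> \<in> K" "\<rho> \<noteq> \<sigma>" "\<rho> \<noteq> \<tau>" using that L by simp_all
    then show "finite \<rho>" using K by (simp add: simplicial_complex_def)
    have "\<rho>' \<in> K" using K \<open>\<rho> \<in> K\<close> that by (simp add: simplicial_complex_def)
    \<comment> \<open>A surviving \<rho> does not contain \<tau>, so none of its faces is \<tau> or
      \<sigma>, and all of them survive.\<close>
    moreover have "\<not> \<tau> \<subseteq> \<rho>" using free \<open>\<rho> \<in> K\<close> \<open>\<rho> \<noteq> \<sigma>\<close> \<open>\<rho> \<noteq> \<tau>\<close> by metis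
    ultimately show "\<rho>' \<in> L" using L that \<open>\<tau> \<subseteq> \<sigma>\<close> by blast
  qed
  then have "simplicial_complex L" unfolding simplicial_complex_def by blast
  \<comment> \<open>The threshold \<open>Suc s\<close> keeps the empty simplex out of the
    pair.\<close>
  moreover have "\<sigma> \<noteq> {}" "\<tau> \<noteq> {}" using * by auto
  ultimately have "free_pair K \<sigma> \<tau>" using * L by (simp add: free_pair_def)
  then show ?thesis using \<open>simplicial_complex L\<close> L by (auto simp: elementary_collapse_def)
qed

lemma collapses_below_collapses_on:
  assumes "simplicial_complex K" "collapses_below (Suc s) K"
  shows "\<exists>L. simplicial_complex L \<and> L \<subseteq> K \<and> collapses_on K L \<and> (\<forall>\<sigma>\<in>L. card \<sigma> \<le> Suc s)"
proof -
  obtain L where L: "(collapse_step (Suc s))\<^sup>*\<^sup>* K L" "\<forall>\<sigma>\<in>L. card \<sigma> \<le> Suc s"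
    using assms(2) unfolding collapses_below_def by blast
  from L(1) have "simplicial_complex L \<and> elementary_collapse\<^sup>*\<^sup>* K L"
  proof (induction rule: rtranclp_induct)
    case (step L L')
    then show ?case using collapse_step_elementary by (metis rtranclp.rtrancl_into_rtrancl)
  qed (use assms in simp)
  then show ?thesis unfolding collapses_on_def using L collapse_steps_subset by blast
qed

section \<open>Cliques\<close>

text \<open>The vertex set is a parameter because deletions and links of vertices are again of this
  form, with the same \<open>E\<close>.\<close>

definition cliques :: "('a \<Rightarrow> 'a \<Rightarrow> bool) \<Rightarrow> 'a set \<Rightarrow> 'a set set" where
  "cliques E V = {\<sigma>. \<sigma> \<subseteq> V \<and> (\<forall>u\<in>\<sigma>. \<forall>v\<in>\<sigma>. u \<noteq> v \<longrightarrow> E u v)}"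

lemma cliques_split:
  assumes "v \<in> V" and sym: "symp E"
  shows "cliques E V = cliques E (V - {v}) \<union> insert v ` cliques E {u \<in> V - {v}. E u v}"
    (is "?l = ?a \<union> ?b")
proof
  show "?l \<subseteq> ?a \<union> ?b"
  proof
    fix \<sigma> assume \<sigma>: "\<sigma> \<in> ?l"
    show "\<sigma> \<in> ?a \<union> ?b"
    proof (cases "v \<in> \<sigma>")
      case True
      then have "\<sigma> = insert v (\<sigma> - {v})" by auto
      moreover have "\<sigma> - {v} \<in> cliques E {u \<in> V - {v}. E u v}"
        using \<sigma> True by (auto simp: cliques_def)
      ultimately show ?thesis by blast
    qed (use \<sigma> in \<open>auto simp: cliques_def\<close>)
  qed
  show "?a \<union> ?b \<subseteq> ?l"
    using assms by (auto simp: cliques_def dest: sympD)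
qed

lemma collapses_below_cliques:
  assumes "finite V" "v \<in> V" "symp E"
    and "collapses_below s (cliques E {u \<in> V - {v}. E u v})"
    and "collapses_below (Suc s) (cliques E (V - {v}))"
  shows "collapses_below (Suc s) (cliques E V)"
proof -
  have "finite \<rho>" if "\<rho> \<in> cliques E {u \<in> V - {v}. E u v}" for \<rho>
    using that \<open>finite V\<close> finite_subset[of \<rho> V] by (auto simp: cliques_def)
  then show ?thesis
    unfolding cliques_split[OF assms(2,3)]
    by (intro collapses_below_cone assms(4,5)) (auto simp: cliques_def)
qed

section \<open>Projections of Gram matrices\<close>

lemma subspace_vanishing:
  fixes S :: "('a::field^'n) set"
  assumes "vec.subspace S"
  shows "vec.subspace {x \<in> S. x $ a = 0}"
  using assms by (auto simp: vec.subspace_def)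

text \<open>Ranks are tracked as dimensions of a subspace containing all rows; \<open>y\<close>
  shows that the hyperplane cuts it properly.\<close>

lemma dim_vanishing:
  fixes S :: "('a::field^'n) set"
  assumes S: "vec.subspace S" and "y \<in> S" "y $ a \<noteq> 0"
  shows "vec.dim {x \<in> S. x $ a = 0} < vec.dim S"
proof (rule vec.dim_psubset)
  show "vec.span {x \<in> S. x $ a = 0} \<subset> vec.span S"
    using assms subspace_vanishing[OF S, of a] by (auto simp: vec.span_eq_iff[THEN iffD2])
qed

text \<open>Here \<open>p\<close>, \<open>q\<close>, \<open>M\<close> are the Gram entries of the
  plane, \<open>x\<close>, \<open>y\<close> the entries of two rows at \<open>a\<close>, and
  \<open>X\<close>, \<open>Y\<close> those at \<open>w\<close>. The determinant is close to
  \<open>- M * M\<close>, and each summand of the numerator has a tiny factor beside at most two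
  factors of size \<open>cmod M\<close>. The three summands quadratic in that size give about
  3\<epsilon>; the rest is slack.\<close>

lemma schur_correction_bound:
  fixes p q M x y X Y :: complex
  assumes p: "cmod p \<le> \<epsilon>" and q: "cmod q \<le> \<epsilon>" and x: "cmod x \<le> \<epsilon>" and y: "cmod y \<le> \<epsilon>"
    and X: "cmod X \<le> cmod M" and Y: "cmod Y \<le> cmod M"
    and M: "16 * \<epsilon> \<le> cmod M" and pos: "0 < \<epsilon>"
  shows "p * q - M * M \<noteq> 0"
    and "cmod ((q * x * y - M * (x * Y + X * y) + p * X * Y) / (p * q - M * M)) \<le> 4 * \<epsilon>"
proof -
  let ?m = "cmod M"
  have e2: "256 * (\<epsilon> * \<epsilon>) \<le> ?m * ?m"
    using mult_mono[OF M M] pos by simp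
  have "cmod (p * q) \<le> \<epsilon> * \<epsilon>"
    unfolding norm_mult using p q pos by (intro mult_mono) auto
  moreover have "?m * ?m - cmod (p * q) \<le> cmod (p * q - M * M)"
    using norm_triangle_ineq2[of "M * M" "p * q"] by (simp add: norm_mult norm_minus_commute)
  ultimately have det: "?m * ?m * (255 / 256) \<le> cmod (p * q - M * M)"
    using e2 by simp
  have mm: "0 < ?m * ?m" using M pos by (intro mult_pos_pos) auto
  then show nz: "p * q - M * M \<noteq> 0" using det by auto
  have 1: "cmod (q * x * y) \<le> \<epsilon> * \<epsilon> * \<epsilon>"
    unfolding norm_mult using q x y pos by (intro mult_mono) auto
  have 2: "cmod (M * (x * Y)) \<le> ?m * (\<epsilon> * ?m)" "cmod (M * (X * y)) \<le> ?m * (?m * \<epsilon>)"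
    unfolding norm_mult using x y X Y pos by (intro mult_mono; auto)+
  have 3: "cmod (p * X * Y) \<le> \<epsilon> * ?m * ?m"
    unfolding norm_mult using p X Y pos by (intro mult_mono) auto
  have "cmod (q * x * y - M * (x * Y + X * y) + p * X * Y)
      \<le> cmod (q * x * y) + (cmod (M * (x * Y)) + cmod (M * (X * y))) + cmod (p * X * Y)"
    unfolding distrib_left by (smt (verit) norm_triangle_ineq norm_triangle_ineq4)
  also have "\<dots> \<le> \<epsilon> * (\<epsilon> * \<epsilon>) + 3 * (\<epsilon> * (?m * ?m))"
    using 1 2 3 by (simp add: algebra_simps)
  also have "\<dots> \<le> \<epsilon> * (?m * ?m * (1 / 256)) + 3 * (\<epsilon> * (?m * ?m))"
    using e2 pos by (intro add_right_mono mult_left_mono) auto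
  also have "\<dots> = (\<epsilon> * (?m * ?m)) * (769 / 256)" by simp
  \<comment> \<open>Rounded up to 1020 = 4 * 255 to match the lower bound 255/256 for the
    determinant.\<close>
  also have "\<dots> \<le> (\<epsilon> * (?m * ?m)) * (1020 / 256)"
    using pos mm by (intro mult_left_mono) auto
  also have "\<dots> = 4 * \<epsilon> * (?m * ?m * (255 / 256))" by simp
  also have "\<dots> \<le> 4 * \<epsilon> * cmod (p * q - M * M)"
    using det pos by (intro mult_left_mono) auto
  finally show "cmod ((q * x * y - M * (x * Y + X * y) + p * X * Y) / (p * q - M * M)) \<le> 4 * \<epsilon>"
    using nz by (simp add: norm_divide divide_le_eq)
qed

text \<open>\<open>schur H a w b\<close> is the orthogonal projection of row \<open>b\<close> along the plane of \<open>a\<close> and \<open>w\<close>: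
the coefficients of \<open>H a\<close> and \<open>H w\<close> come from inverting the Gram matrix of that plane.\<close>

definition schur :: "('n \<Rightarrow> 'a::field^'n) \<Rightarrow> 'n \<Rightarrow> 'n \<Rightarrow> 'n \<Rightarrow> 'a^'n" where
  "schur H a w b =
    H b - (((H w $ w * H b $ a - H a $ w * H b $ w) / (H a $ a * H w $ w - H a $ w * H a $ w)) *s H a
         + ((H a $ a * H b $ w - H a $ w * H b $ a) / (H a $ a * H w $ w - H a $ w * H a $ w)) *s H w)"

text \<open>Over one denominator the correction is visibly symmetric in \<open>b\<close> and
  \<open>c\<close> and has the shape of \<open>schur_correction_bound\<close>.\<close>

lemma schur_component:
  assumes sym: "\<And>b c. H b $ c = H c $ b"
  shows "schur H a w b $ c = H b $ c -
    (H w $ w * H b $ a * H c $ a - H a $ w * (H b $ a * H c $ w + H b $ w * H c $ a)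
      + H a $ a * H b $ w * H c $ w) / (H a $ a * H w $ w - H a $ w * H a $ w)"
  using sym[of a c] sym[of w c]
  by (simp add: schur_def diff_divide_distrib add_divide_distrib algebra_simps)

lemma schur_symmetric:
  assumes "\<And>b c. H b $ c = H c $ b"
  shows "schur H a w b $ c = schur H a w c $ b"
  unfolding schur_component[OF assms] using assms[of b c] by (simp add: algebra_simps)

lemma schur_vanishes:
  assumes sym: "\<And>b c. H b $ c = H c $ b" and nz: "H a $ a * H w $ w - H a $ w * H a $ w \<noteq> 0"
  shows "schur H a w b $ a = 0" "schur H a w b $ w = 0"
  unfolding schur_component[OF sym] using nz sym[of w a]
  by (simp_all add: divide_simps) (simp_all add: algebra_simps)

lemma schur_subspace:
  assumes "vec.subspace S" "\<And>b. H b \<in> S"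
  shows "schur H a w b \<in> S"
  unfolding schur_def using assms
  by (intro vec.subspace_diff vec.subspace_add vec.subspace_scale) auto

lemma dim_schur:
  fixes H :: "'n \<Rightarrow> 'a::field^'n"
  assumes S: "vec.subspace S" "\<And>b. H b \<in> S" and sym: "\<And>b c. H b $ c = H c $ b"
    and nz: "H a $ a * H w $ w - H a $ w * H a $ w \<noteq> 0" and aw: "H a $ w \<noteq> 0"
  shows "vec.dim {x \<in> {x \<in> S. x $ a = 0}. x $ w = 0} + 2 \<le> vec.dim S"
proof -
  let ?T = "{x \<in> S. x $ a = 0}"
  \<comment> \<open>This combination of rows \<open>a\<close> and \<open>w\<close> vanishes at
    \<open>a\<close>, while its entry at \<open>w\<close> is the determinant. It witnesses the
    second drop in dimension; \<open>H w\<close> witnesses the first.\<close>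
  define y where "y = H a $ a *s H w - H a $ w *s H a"
  have "y \<in> S" unfolding y_def using S
    by (intro vec.subspace_diff vec.subspace_scale) auto
  moreover have "y $ a = 0" "y $ w \<noteq> 0"
    using nz sym[of w a] by (simp_all add: y_def)
  ultimately have "vec.dim {x \<in> ?T. x $ w = 0} < vec.dim ?T"
    by (intro dim_vanishing[of _ y] subspace_vanishing S) auto
  moreover have "vec.dim ?T < vec.dim S"
    using aw sym[of a w] S by (intro dim_vanishing[of _ "H w"]) auto
  ultimately show ?thesis by linarith
qed

section \<open>The collapse\<close>

text \<open>A link costs two dimensions and lowers \<open>s\<close> by one; it worsens \<epsilon> to
  5\<epsilon> and \<delta> to \<open>\<delta> - 4 * \<epsilon>\<close>, which one factor 16 of the
  gap absorbs. A deletion keeps the matrix and all constants.\<close>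

lemma collapses_below_tiny_diagonal:
  fixes H :: "'n::finite \<Rightarrow> complex^'n" and E :: "'n \<Rightarrow> 'n \<Rightarrow> bool"
  assumes E: "symp E"
    and "vec.subspace S" "\<And>b. H b \<in> S" "vec.dim S \<le> 2 * s + 1" "\<And>b c. H b $ c = H c $ b"
    and "\<And>b. b \<in> V \<Longrightarrow> cmod (H b $ b) < \<epsilon>"
    and "\<And>b c. b \<in> V \<Longrightarrow> c \<in> V \<Longrightarrow> b \<noteq> c \<Longrightarrow> E b c \<Longrightarrow> cmod (H b $ c) < \<epsilon>"
    and "\<And>b c. b \<in> V \<Longrightarrow> c \<in> V \<Longrightarrow> b \<noteq> c \<Longrightarrow> \<not> E b c \<Longrightarrow> \<delta> < cmod (H b $ c)"
    and "16 ^ Suc s * \<epsilon> \<le> \<delta>"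
  shows "collapses_below s (cliques E V)"
  using assms(2-)
proof (induction "card V" arbitrary: V H S s \<epsilon> \<delta> rule: less_induct)
  case less
  note S = less.prems(1-3) and sym = less.prems(4) and diag = less.prems(5)
    and edge = less.prems(6) and nonedge = less.prems(7) and gap = less.prems(8)
  show ?case
  proof (cases "\<exists>a\<in>V. \<exists>w\<in>V. a \<noteq> w \<and> \<not> E a w")
    case False
    then have "cliques E V = Pow V" by (auto simp: cliques_def)
    then show ?thesis by (simp add: collapses_below_Pow)
  next
    case True
    then obtain a0 w0 where aw0: "a0 \<in> V" "w0 \<in> V" "a0 \<noteq> w0" "\<not> E a0 w0" by blast
    have "finite (V \<times> V)" "V \<times> V \<noteq> {}" using aw0 by auto
    \<comment> \<open>The sign turns a minimum into a maximum. Diagonal pairs may compete, but a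
      nonedge entry exceeds \<delta> and beats them all.\<close>
    from ex_is_arg_min_if_finite[OF this, of "\<lambda>(b, c). - cmod (H b $ c)"]
    obtain a w where aw: "a \<in> V" "w \<in> V"
      and max: "\<And>b c. b \<in> V \<Longrightarrow> c \<in> V \<Longrightarrow> cmod (H b $ c) \<le> cmod (H a $ w)"
      by (force simp: is_arg_min_def not_less)
    have pos: "0 < \<epsilon>" using diag[OF aw(1)] norm_ge_zero[of "H a $ a"] by linarith
    have pow1: "\<epsilon> \<le> 16 ^ s * \<epsilon>" using pos by simp
    have gap': "16 * \<epsilon> \<le> \<delta>" using gap pow1 by simp
    have large: "\<delta> < cmod (H a $ w)" using nonedge[OF aw0] max[OF aw0(1,2)] by simp
    let ?D = "H a $ a * H w $ w - H a $ w * H a $ w"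
    \<comment> \<open>Only the entries at \<open>a\<close> have to be tiny, as they are for
      neighbours of \<open>a\<close>; those at \<open>w\<close> are bounded by maximality.\<close>
    have bound: "?D \<noteq> 0 \<and> cmod ((H w $ w * H b $ a * H c $ a
        - H a $ w * (H b $ a * H c $ w + H b $ w * H c $ a) + H a $ a * H b $ w * H c $ w) / ?D) \<le> 4 * \<epsilon>"
      if "b \<in> V" "c \<in> V" "cmod (H b $ a) < \<epsilon>" "cmod (H c $ a) < \<epsilon>" for b c
      using that aw diag max large gap' pos
      by (intro conjI schur_correction_bound) (auto intro: less_imp_le)
    have nz: "?D \<noteq> 0" using bound[of a a] aw diag by blast
    have aw_nz: "H a $ w \<noteq> 0" using large gap' pos by auto
    let ?S = "{x \<in> {x \<in> S. x $ a = 0}. x $ w = 0}"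
    have dim: "vec.dim ?S + 2 \<le> vec.dim S"
      by (rule dim_schur[of S H]) (use S sym nz aw_nz in auto)
    \<comment> \<open>For \<open>s = 0\<close> the space has dimension at most 1, too small for the
      plane of \<open>a\<close> and \<open>w\<close>, so a nonedge forces \<open>s\<close> to be
      positive.\<close>
    then obtain t where t: "s = Suc t" using S(3) by (cases s) auto
    let ?V = "{u \<in> V - {a}. E u a}"
    have close: "cmod (schur H a w b $ c - H b $ c) \<le> 4 * \<epsilon>" if "b \<in> ?V" "c \<in> ?V" for b c
      unfolding schur_component[of H, OF sym] using bound[of b c] edge aw that by simp
    have tri: "cmod (schur H a w b $ c) \<le> cmod (H b $ c) + 4 * \<epsilon>"
      "cmod (H b $ c) - 4 * \<epsilon> \<le> cmod (schur H a w b $ c)" if "b \<in> ?V" "c \<in> ?V" for b c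
      using close[OF that] norm_triangle_ineq2[of "schur H a w b $ c" "H b $ c"]
        norm_triangle_ineq3[of "schur H a w b $ c" "H b $ c"] by linarith+
    have "collapses_below t (cliques E ?V)"
    proof (rule less.hyps[of _ ?S "schur H a w" _ "5 * \<epsilon>" "\<delta> - 4 * \<epsilon>"])
      show "card ?V < card V" using aw by (intro psubset_card_mono) auto
      show "vec.subspace ?S" by (intro subspace_vanishing S)
      show "schur H a w b \<in> ?S" for b
        using schur_subspace[of S H, OF S(1,2)] schur_vanishes[of H, OF sym nz] by simp
      show "vec.dim ?S \<le> 2 * t + 1" using dim S(3) t by simp
      show "schur H a w b $ c = schur H a w c $ b" for b c by (rule schur_symmetric[OF sym])
      show "cmod (schur H a w b $ b) < 5 * \<epsilon>" if "b \<in> ?V" for b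
        using tri(1)[OF that that] diag[of b] that by simp
      show "cmod (schur H a w b $ c) < 5 * \<epsilon>" if "b \<in> ?V" "c \<in> ?V" "b \<noteq> c" "E b c" for b c
        using tri(1)[OF that(1,2)] edge[of b c] that by simp
      show "\<delta> - 4 * \<epsilon> < cmod (schur H a w b $ c)" if "b \<in> ?V" "c \<in> ?V" "b \<noteq> c" "\<not> E b c" for b c
        using tri(2)[OF that(1,2)] nonedge[of b c] that by simp
      \<comment> \<open>The need is at most \<open>(5 + 4) * 16 ^ s * \<epsilon>\<close>, below the
        available \<open>16 * 16 ^ s * \<epsilon>\<close>.\<close>
      show "16 ^ Suc t * (5 * \<epsilon>) \<le> \<delta> - 4 * \<epsilon>" using gap pow1 pos
        by (simp only: t power_Suc algebra_simps)
    qed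
    moreover have "collapses_below (Suc t) (cliques E (V - {a}))"
      unfolding t[symmetric]
    proof (rule less.hyps[OF _ S sym _ _ _ gap])
      show "card (V - {a}) < card V" using aw by (intro psubset_card_mono) auto
    qed (use diag edge nonedge in auto)
    ultimately show ?thesis
      unfolding t using collapses_below_cliques[OF _ aw(1) E] by simp
  qed
qed

text \<open>Projecting along one unit vector drops only one dimension, but leaves the odd bound
  \<open>2 * s + 1\<close> and the tiny diagonal that the later steps start from. Every vertex is
  removed this way, always from the same matrix.\<close>

lemma collapses_below_unit_diagonal:
  fixes H :: "'n::finite \<Rightarrow> complex^'n" and E :: "'n \<Rightarrow> 'n \<Rightarrow> bool"
  assumes E: "symp E"
    and S: "vec.subspace S" "\<And>b. H b \<in> S" "vec.dim S \<le> 2 * Suc s"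
    and sym: "\<And>b c. H b $ c = H c $ b" and unit: "\<And>b. H b $ b = 1"
    and edge: "\<And>b c. b \<noteq> c \<Longrightarrow> E b c \<Longrightarrow> cmod (H b $ c - 1) < \<epsilon>"
    and nonedge: "\<And>b c. b \<noteq> c \<Longrightarrow> \<not> E b c \<Longrightarrow> \<delta> < cmod (H b $ c - 1)"
    and gap: "16 ^ Suc (Suc s) * \<epsilon> \<le> \<delta>" and pos: "0 < \<epsilon>" and "\<epsilon> < 1"
  shows "collapses_below (Suc s) (cliques E V)"
proof (induction "card V" arbitrary: V rule: less_induct)
  case less
  show ?case
  proof (cases "V = {}")
    case True
    then have "cliques E V = Pow V" by (auto simp: cliques_def)
    then show ?thesis by (simp add: collapses_below_Pow)
  next
    case False
    then obtain v where v: "v \<in> V" by blast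
    let ?V = "{u \<in> V - {v}. E u v}" and ?S = "{x \<in> S. x $ v = 0}"
    define P where "P b = H b - H b $ v *s H v" for b
    have comp: "P b $ c = H b $ c - H b $ v * H c $ v" for b c
      using sym[of v c] by (simp add: P_def)
    have close: "cmod (P b $ c - (H b $ c - 1)) \<le> 3 * \<epsilon>" if "b \<in> ?V" "c \<in> ?V" for b c
    proof -
      let ?x = "H b $ v - 1" and ?y = "H c $ v - 1"
      have xy: "cmod ?x \<le> \<epsilon>" "cmod ?y \<le> \<epsilon>"
        using edge[of b v] edge[of c v] that by auto
      then have "cmod (?x * ?y) \<le> 1 * \<epsilon>"
        unfolding norm_mult using \<open>\<epsilon> < 1\<close> by (intro mult_mono) auto
      \<comment> \<open>Both factors of \<open>H b $ v * H c $ v\<close> are close to 1, so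
        projecting nearly subtracts 1.\<close>
      moreover have "P b $ c - (H b $ c - 1) = - (?x + ?y + ?x * ?y)"
        by (simp add: comp algebra_simps)
      ultimately show ?thesis
        using xy norm_triangle_ineq[of "?x + ?y" "?x * ?y"] norm_triangle_ineq[of ?x ?y]
        by (simp only: norm_minus_cancel)
    qed
    have tri: "cmod (P b $ c) \<le> cmod (H b $ c - 1) + 3 * \<epsilon>"
      "cmod (H b $ c - 1) - 3 * \<epsilon> \<le> cmod (P b $ c)" if "b \<in> ?V" "c \<in> ?V" for b c
      using close[OF that] norm_triangle_ineq2[of "P b $ c" "H b $ c - 1"]
        norm_triangle_ineq3[of "P b $ c" "H b $ c - 1"] by linarith+
    have pow1: "\<epsilon> \<le> 16 ^ s * \<epsilon>" using pos by simp
    have "collapses_below s (cliques E ?V)"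
    proof (rule collapses_below_tiny_diagonal[of _ ?S P _ _ "4 * \<epsilon>" "\<delta> - 3 * \<epsilon>"])
      show "vec.subspace ?S" by (intro subspace_vanishing S)
      show "P b \<in> ?S" for b
        unfolding P_def using S unit
        by (auto intro: vec.subspace_diff vec.subspace_scale)
      have "vec.dim ?S < vec.dim S"
        using unit S by (intro dim_vanishing[of _ "H v"]) auto
      then show "vec.dim ?S \<le> 2 * s + 1" using S(3) by simp
      show "P b $ c = P c $ b" for b c using sym[of b c] by (simp add: comp)
      show "cmod (P b $ b) < 4 * \<epsilon>" if "b \<in> ?V" for b
        \<comment> \<open>The unit diagonal contributes nothing, so only the error 3\<epsilon> is
          left.\<close>
        using tri(1)[OF that that] pos unit by simp
      show "cmod (P b $ c) < 4 * \<epsilon>" if "b \<in> ?V" "c \<in> ?V" "b \<noteq> c" "E b c" for b c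
        using tri(1)[OF that(1,2)] edge[of b c] that by simp
      show "\<delta> - 3 * \<epsilon> < cmod (P b $ c)" if "b \<in> ?V" "c \<in> ?V" "b \<noteq> c" "\<not> E b c" for b c
        using tri(2)[OF that(1,2)] nonedge[of b c] that by simp
      show "16 ^ Suc s * (4 * \<epsilon>) \<le> \<delta> - 3 * \<epsilon>" using gap pow1 pos
        by (simp only: power_Suc algebra_simps)
    qed (rule E)
    moreover have "collapses_below (Suc s) (cliques E (V - {v}))"
      using v by (intro less.hyps psubset_card_mono) auto
    ultimately show ?thesis
      using collapses_below_cliques[OF _ v E] by simp
  qed
qed

theorem theorem3:
  fixes G :: "complex^'n^'n" and r :: nat and \<kappa> :: real
  assumes sym: "\<And>u v. G $ u $ v = G $ v $ u"
    and diag: "\<And>u. G $ u $ u = 1"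
    and rk: "rank G \<le> 2 * r"
    and kpos: "0 < \<kappa>" and klt1: "\<kappa> < 1"
    and gap: "\<And>u v. cmod (G $ u $ v - 1) > \<kappa> \<or> cmod (G $ u $ v - 1) < 2 powr (- 4 * (real r + 1)) * \<kappa>"
  shows "\<exists>L. simplicial_complex L \<and> L \<subseteq> clique_complex G \<kappa> \<and>
           collapses_on (clique_complex G \<kappa>) L \<and> (\<forall>\<sigma>\<in>L. simplex_dim \<sigma> < int r)"
proof -
  define \<epsilon> where "\<epsilon> = \<kappa> / 16 ^ Suc r"
  define S where "S = vec.span (rows G)"
  have S: "vec.subspace S" "G $ b \<in> S" "vec.dim S \<le> 2 * r" for b
    using rk by (auto simp: S_def row_rank_def_gen rows_def row_def
        intro!: vec.span_base)
  \<comment> \<open>A row with a unit diagonal entry is nonzero, so the rank is positive and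
    \<open>r = 0\<close> cannot occur.\<close>
  have "vec.dim {x \<in> S. x $ u = 0} < vec.dim S" for u
    using S diag[of u] by (intro dim_vanishing[of _ "G $ u"]) auto
  then obtain s where s: "r = Suc s" using S(3) by (cases r) auto
  have "2 powr (- 4 * (real r + 1)) = 1 / (2 powr 4) powr real (Suc r)"
    by (simp only: powr_powr) (simp add: powr_minus_divide[symmetric] algebra_simps)
  also have "(2 powr 4) powr real (Suc r) = (16::real) ^ Suc r"
    by (subst powr_realpow) simp_all
  finally have \<epsilon>: "2 powr (- 4 * (real r + 1)) * \<kappa> = \<epsilon>" by (simp add: \<epsilon>_def)
  have "1 < (16::real) ^ Suc r" by (rule one_less_power) auto
  then have eps: "0 < \<epsilon>" "\<epsilon> < \<kappa>" "16 ^ Suc r * \<epsilon> = \<kappa>"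
    using kpos by (auto simp: \<epsilon>_def divide_less_eq)
  have "collapses_below (Suc s) (cliques (Gamma_edge G \<kappa>) UNIV)"
  proof (rule collapses_below_unit_diagonal[of _ S "\<lambda>b. G $ b" _ \<epsilon> \<kappa>])
    show "symp (Gamma_edge G \<kappa>)" using sym by (auto simp: symp_def Gamma_edge_def)
    show "cmod (G $ b $ c - 1) < \<epsilon>" if "b \<noteq> c" "Gamma_edge G \<kappa> b c" for b c
      using gap[of b c] that unfolding \<epsilon> Gamma_edge_def by simp
    \<comment> \<open>A nonedge only gives a distance of at least \<kappa>; the gap hypothesis makes
      it strict.\<close>
    show "\<kappa> < cmod (G $ b $ c - 1)" if "b \<noteq> c" "\<not> Gamma_edge G \<kappa> b c" for b c
      using gap[of b c] that eps unfolding \<epsilon> Gamma_edge_def by simp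
  qed (use S sym diag eps klt1 s in auto)
  moreover have "cliques (Gamma_edge G \<kappa>) UNIV = clique_complex G \<kappa>"
    by (simp add: cliques_def clique_complex_def)
  moreover have "simplicial_complex (clique_complex G \<kappa>)"
    by (auto simp: simplicial_complex_def clique_complex_def subset_iff)
  ultimately obtain L where "simplicial_complex L" "L \<subseteq> clique_complex G \<kappa>"
    "collapses_on (clique_complex G \<kappa>) L" "\<forall>\<sigma>\<in>L. card \<sigma> \<le> r"
    using collapses_below_collapses_on s by metis
  then show ?thesis by (intro exI[of _ L]) (auto simp: simplex_dim_def)
qed

end
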